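(* The quantity $\zeta(n) = \max\{ \mathsf{zn}(S[i..]) / \mathsf{zn}(S) \mid S \in \Sigma^n,\ 1 < i \leq n\}$ is asymptotically lower bounded by $4/3$, that is, $\liminf_{n\to\infty}\zeta(n)\ge 4/3$. Here the alphabet $\Sigma$ is not bounded in size (it may grow with $n$).
   Context: Strings are indexed from $1$; $S[i..j]$ is the substring from position $i$ to $j$ (empty if $j<i$), and $S[i..]=S[i..|S|]$. $\mathsf{lcp}(X,Y)$ is the length of the longest common prefix of $X$ and $Y$. Non self-referencing LZ77 factorization: $\mathsf{LZN}(S)$ is the factorization $S=f_1\cdots f_{z}$ defined greedily from left to right as follows. Let $u_i=|f_1\cdots f_{i-1}|+1$ and let $p_i=\max_{1\le j<u_i}\mathsf{lcp}(S[u_i..],S[j..u_i-1])$ (with $p_i=0$ if $i=1$). Then $f_i=S[u_i..\min\{u_i+p_i,|S|\}]$. That is, $f_i$ is a fresh letter or the shortest prefix of $S[u_i..]$ with no occurrence inside $S[1..u_i-1]$ (or all of $S[u_i..]$ if that occurs in $S[1..u_i-1]$). The size $\mathsf{zn}(S)$ is the number $z$ of factors. *)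

theory Defs
  imports Complex_Main "HOL-Library.Sublist" "HOL-Library.Extended_Real"
begin

text \<open>Positions in strings are counted from 1, unlike the library's list indexing from 0.\<close>

definition substr :: "'a list \<Rightarrow> nat \<Rightarrow> nat \<Rightarrow> 'a list" where
  "substr S i j = take (Suc j - i) (drop (i - 1) S)"

definition suffix_at :: "'a list \<Rightarrow> nat \<Rightarrow> 'a list" where
  "suffix_at S i = substr S i (length S)"

definition lcp :: "'a list \<Rightarrow> 'a list \<Rightarrow> nat" where
  "lcp X Y = length (longest_common_prefix X Y)"

definition prev_len :: "'a list \<Rightarrow> nat \<Rightarrow> nat" where
  "prev_len S u =
     (if u = 1 then 0
      else Max ((\<lambda>j. lcp (suffix_at S u) (substr S j (u - 1))) ` {1..<u}))"

text \<open>The factors of \<open>S\<close> from position \<open>u\<close> on, where \<open>u\<close> is the first position of a factor.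
  Each source must end before position \<open>u\<close>, so no self-reference is possible.\<close>

function lzn_from :: "'a list \<Rightarrow> nat \<Rightarrow> 'a list list" where
  "lzn_from S u =
     (if u > length S then []
      else let v = min (u + prev_len S u) (length S)
           in substr S u v # lzn_from S (Suc v))"
  by pat_completeness auto
termination
  by (relation "measure (\<lambda>(S, u). Suc (length S) - u)") auto

declare lzn_from.simps [simp del]

definition LZN :: "'a list \<Rightarrow> 'a list list" where
  "LZN S = lzn_from S 1"

definition zn :: "'a list \<Rightarrow> nat" where
  "zn S = length (LZN S)"

text \<open>The alphabet is unbounded: letters are arbitrary natural numbers, so every string over
  every finite alphabet is covered up to renaming of letters.  The set is finite because
  \<open>zn S \<le> length S\<close>, see below, and it is nonempty for \<open>n \<ge> 2\<close>.\<close>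

definition zeta_ratios :: "nat \<Rightarrow> real set" where
  "zeta_ratios n =
     {real (zn (suffix_at S i)) / real (zn S) | (S :: nat list) i. length S = n \<and> 1 < i \<and> i \<le> n}"

definition zeta :: "nat \<Rightarrow> real" where
  "zeta n = Max (zeta_ratios n)"

lemma length_lzn_from: "length (lzn_from S u) \<le> Suc (length S) - u"
proof (induction S u rule: lzn_from.induct)
  case (1 S u)
  show ?case
  proof (cases "u > length S")
    case True
    then show ?thesis by (simp add: lzn_from.simps)
  next
    case False
    define v where "v = min (u + prev_len S u) (length S)"
    have "u \<le> v" using False by (simp add: v_def)
    moreover have "length (lzn_from S (Suc v)) \<le> Suc (length S) - Suc v"
      using "1.IH"[OF False v_def] .
    moreover have "length (lzn_from S u) = Suc (length (lzn_from S (Suc v)))"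
      using False by (subst lzn_from.simps) (simp add: v_def Let_def)
    ultimately show ?thesis using False by (simp add: v_def)
  qed
qed

lemma zn_le_length: "zn S \<le> length S"
  using length_lzn_from[of S 1] by (simp add: zn_def LZN_def)

lemma finite_zeta_ratios: "finite (zeta_ratios n)"
proof (rule finite_subset)
  show "zeta_ratios n \<subseteq> (\<lambda>(a, b). real a / real b) ` ({..n} \<times> {..n})"
  proof
    fix r assume "r \<in> zeta_ratios n"
    then obtain S :: "nat list" and i where r: "r = real (zn (suffix_at S i)) / real (zn S)"
      and "length S = n"
      by (auto simp: zeta_ratios_def)
    moreover have "length (suffix_at S i) \<le> length S"
      by (simp add: suffix_at_def substr_def)
    ultimately have "zn (suffix_at S i) \<le> n" "zn S \<le> n"
      using zn_le_length[of S] zn_le_length[of "suffix_at S i"] by auto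
    with r show "r \<in> (\<lambda>(a, b). real a / real b) ` ({..n} \<times> {..n})"
      by (auto intro!: image_eqI[where x = "(zn (suffix_at S i), zn S)"])
  qed
qed simp

lemma zeta_ratios_nonempty: "n \<ge> 2 \<Longrightarrow> zeta_ratios n \<noteq> {}"
  by (auto simp: zeta_ratios_def intro!: exI[where x = "replicate n 0"] exI[where x = 2])

end

theory Submission
  imports Defs "HOL-Library.Discrete_Functions"
begin

text \<open>Write \<open>a\<close> for one fixed letter and let \<open>$\<^sub>0, $\<^sub>1, \<dots>\<close> be further letters, pairwise distinct.
  In \<open>S = a\<^sup>p $\<^sub>0 \<cdot> a $\<^sub>1 \<cdot> aa $\<^sub>2 \<cdots> a\<^sup>k $\<^sub>k\<close> with \<open>p \<ge> k\<close>, the prefix \<open>a\<^sup>p $\<^sub>0\<close> costs only about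
  \<open>log\<^sub>2 p\<close> factors, after which every block \<open>a\<^sup>j $\<^sub>j\<close> is a single factor.  Once the prefix
  \<open>a\<^sup>p $\<^sub>0\<close> is removed, the longest run of \<open>a\<close> before the block \<open>a\<^sup>j $\<^sub>j\<close> is \<open>a\<^sup>j\<^sup>-\<^sup>1\<close>, so that this
  block splits into the two factors \<open>a\<^sup>j\<close> and \<open>$\<^sub>j\<close>.  For \<open>n = |S|\<close> and \<open>k = \<lfloor>\<surd>n\<rfloor>\<close> the ratio
  \<open>2 k / (k + O(log n))\<close> even tends to 2.\<close>

section \<open>Recognizing the factorization\<close>

text \<open>Certifies greedy factors after the text \<open>A\<close>. The last factor must be new as
  well, so strings whose final factor occurs earlier are excluded; those built below never end that
  way.\<close>

fun lzn_parse :: "'a list \<Rightarrow> 'a list list \<Rightarrow> bool" where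
  "lzn_parse A [] \<longleftrightarrow> True"
| "lzn_parse A (f # fs) \<longleftrightarrow>
     f \<noteq> [] \<and> sublist (butlast f) A \<and> \<not> sublist f A \<and> lzn_parse (A @ f) fs"

lemma lzn_parse_append:
  "lzn_parse A (fs @ gs) \<longleftrightarrow> lzn_parse A fs \<and> lzn_parse (A @ concat fs) gs"
  by (induction fs arbitrary: A) auto

text \<open>A match longer than \<open>w\<close> would put \<open>w @ [c]\<close> inside
  \<open>A\<close>, while an occurrence of \<open>w\<close> in \<open>A\<close> attains
  \<open>length w\<close>.\<close>

lemma prev_len_eq:
  assumes "sublist w A" "\<not> sublist (w @ [c]) A"
  shows "prev_len (A @ w @ c # R) (Suc (length A)) = length w"
proof (cases "A = []")
  case True
  then show ?thesis using assms(1) by (simp add: prev_len_def)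
next
  case False
  let ?S = "A @ w @ c # R" and ?X = "w @ c # R"
  let ?L = "\<lambda>j. lcp (suffix_at ?S (Suc (length A))) (substr ?S j (Suc (length A) - 1))"
  have L: "?L j = lcp ?X (drop (j - 1) A)" if "j \<in> {1..<Suc (length A)}" for j
    using that by (simp add: suffix_at_def substr_def)
  have upper: "?L j \<le> length w" if j: "j \<in> {1..<Suc (length A)}" for j
  proof (rule ccontr)
    let ?l = "longest_common_prefix ?X (drop (j - 1) A)"
    assume "\<not> ?thesis"
    then have "length (w @ [c]) \<le> length ?l" by (simp only: L[OF j]) (simp add: lcp_def)
    moreover have "prefix (w @ [c]) ?X" by simp
    ultimately have "prefix (w @ [c]) ?l"
      using longest_common_prefix_prefix1 prefix_length_prefix by blast
    then have "prefix (w @ [c]) (drop (j - 1) A)"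
      using longest_common_prefix_prefix2 prefix_order.trans by blast
    then have "sublist (w @ [c]) A"
      by (meson prefix_imp_sublist sublist_drop sublist_order.order_trans)
    with assms(2) show False by simp
  qed
  have lower: "\<exists>j \<in> {1..<Suc (length A)}. length w \<le> ?L j"
  \<comment> \<open>An empty \<open>w\<close> may be located at the very end of \<open>A\<close>,
    where its start position leaves the admissible range; position 1 serves instead.\<close>
  proof (cases "w = []")
    case True
    then show ?thesis using False by (intro bexI[of _ 1]) auto
  next
    case w: False
    obtain xs ys where A: "A = xs @ w @ ys" using assms(1) by (auto simp: sublist_def)
    have j: "Suc (length xs) \<in> {1..<Suc (length A)}" using w by (auto simp: A)
    have "prefix w (longest_common_prefix ?X (drop (length xs) A))"
      by (rule longest_common_prefix_max_prefix) (simp_all add: A)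
    then have "length w \<le> lcp ?X (drop (Suc (length xs) - 1) A)"
      by (simp only: lcp_def prefix_length_le diff_Suc_1)
    then have "length w \<le> ?L (Suc (length xs))" by (simp only: L[OF j])
    with j show ?thesis by blast
  qed
  have fin: "finite (?L ` {1..<Suc (length A)})" by simp
  have "?L ` {1..<Suc (length A)} \<noteq> {}" using False by simp
  then have "Max (?L ` {1..<Suc (length A)}) \<le> length w"
    using upper by (intro Max.boundedI[OF fin]) blast+
  moreover have "length w \<le> Max (?L ` {1..<Suc (length A)})"
    using lower Max_ge[OF fin] order.trans by (blast intro: imageI)
  ultimately have "Max (?L ` {1..<Suc (length A)}) = length w" by (rule antisym)
  then show ?thesis using False by (simp add: prev_len_def)
qed

lemma lzn_from_eq:
  assumes "lzn_parse A fs"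
  shows "lzn_from (A @ concat fs) (Suc (length A)) = fs"
  using assms
proof (induction fs arbitrary: A)
  case Nil
  then show ?case by (simp add: lzn_from.simps)
next
  case (Cons f fs)
  define w c where "w = butlast f" and "c = last f"
  have f: "f = w @ [c]" using Cons.prems by (simp add: w_def c_def)
  have "prev_len (A @ w @ c # concat fs) (Suc (length A)) = length w"
    using Cons.prems by (intro prev_len_eq) (auto simp: f)
  moreover have "lzn_from ((A @ f) @ concat fs) (Suc (length (A @ f))) = fs"
    using Cons.prems by (intro Cons.IH) simp
  \<comment> \<open>Position \<open>Suc (length A) + length w\<close> holds \<open>c\<close>, so
    truncation at the end of the string has no effect.\<close>
  ultimately show ?case
    by (subst lzn_from.simps) (simp add: f Let_def substr_def)
qed

lemma zn_concat:
  assumes "lzn_parse [] fs"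
  shows "zn (concat fs) = length fs"
  using lzn_from_eq[OF assms] by (simp add: zn_def LZN_def)

section \<open>The family of strings\<close>

text \<open>In all three families \<open>0\<close> is the letter \<open>a\<close>, and
  \<open>Suc j\<close> is \<open>$\<^sub>j\<close>.\<close>

definition doubling_factors :: "nat \<Rightarrow> nat list list" where
  "doubling_factors t = map (\<lambda>i. replicate (2 ^ i) 0) [0..<t]"

definition block_factors :: "nat \<Rightarrow> nat list list" where
  "block_factors k = map (\<lambda>j. replicate j 0 @ [Suc j]) [1..<Suc k]"

text \<open>How the string of \<open>block_factors k\<close> factorizes with no text before
  it.\<close>

definition split_factors :: "nat \<Rightarrow> nat list list" where
  "split_factors k = concat (map (\<lambda>j. [replicate j 0, [Suc j]]) [1..<Suc k])"

lemma concat_doubling_factors: "concat (doubling_factors t) = replicate (2 ^ t - 1) 0"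
proof (induction t)
  case (Suc t)
  have "2 ^ t - 1 + 2 ^ t = 2 ^ Suc t - (1::nat)" by simp
  with Suc show ?case by (simp add: doubling_factors_def flip: replicate_add)
qed (simp add: doubling_factors_def)

lemma sublist_replicate_mono: "m \<le> n \<Longrightarrow> sublist (replicate m x) (replicate n x)"
  by (metis le_add_diff_inverse replicate_add sublist_append_rightI)

text \<open>Each factor is one letter longer than all the text before it: too long to occur there,
  but without its last letter it is that whole text.\<close>

lemma lzn_parse_doubling_factors: "lzn_parse [] (doubling_factors t)"
proof (induction t)
  case (Suc t)
  have "\<not> sublist (replicate (2 ^ t) 0) (replicate (2 ^ t - 1) (0::nat))"
    using sublist_length_le by fastforce
  moreover have "butlast (replicate (2 ^ t) 0) = replicate (2 ^ t - 1) (0::nat)"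
    by (simp add: butlast_conv_take min_def)
  moreover have "doubling_factors (Suc t) = doubling_factors t @ [replicate (2 ^ t) 0]"
    by (simp add: doubling_factors_def)
  ultimately show ?case
    using Suc by (simp add: lzn_parse_append concat_doubling_factors)
qed (simp add: doubling_factors_def)

lemma not_sublist_fresh: "c \<in> set f \<Longrightarrow> c \<notin> set A \<Longrightarrow> \<not> sublist f A"
  using set_mono_sublist by blast

lemma block_factors_Suc:
  "block_factors (Suc k) = block_factors k @ [replicate (Suc k) 0 @ [Suc (Suc k)]]"
  by (simp add: block_factors_def)

lemma split_factors_Suc:
  "split_factors (Suc k) = split_factors k @ [replicate (Suc k) 0, [Suc (Suc k)]]"
  by (simp add: split_factors_def)

lemma set_concat_block_factors: "set (concat (block_factors k)) \<subseteq> {..Suc k}"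
  by (auto simp: block_factors_def)

lemma concat_split_factors: "concat (split_factors k) = concat (block_factors k)"
  by (induction k) (simp_all add: split_factors_Suc block_factors_Suc,
      simp_all add: split_factors_def block_factors_def)

text \<open>The run of each block occurs in \<open>A\<close>, and its separator is fresh because the
  separators start at 2.\<close>

lemma lzn_parse_block_factors:
  assumes "sublist (replicate k 0) A" "set A \<subseteq> {..1}"
  shows "lzn_parse A (block_factors k)"
  using assms(1)
proof (induction k)
  case (Suc k)
  have "sublist (replicate k 0) A"
    using Suc.prems sublist_replicate_mono[of k "Suc k" 0] sublist_order.order_trans le_SucI order_refl
    by metis
  then have "lzn_parse A (block_factors k)" by (rule Suc.IH)
  moreover have "sublist (replicate (Suc k) 0) (A @ concat (block_factors k))"
    using Suc.prems sublist_append_rightI by (rule sublist_order.order_trans)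
  moreover have "Suc (Suc k) \<notin> set (A @ concat (block_factors k))"
    using assms(2) set_concat_block_factors[of k] by fastforce
  then have "\<not> sublist (replicate (Suc k) 0 @ [Suc (Suc k)]) (A @ concat (block_factors k))"
    by (intro not_sublist_fresh) auto
  ultimately show ?case
    by (simp add: block_factors_Suc lzn_parse_append butlast_append del: replicate_Suc)
qed (simp add: block_factors_def)

text \<open>A run of one letter cannot cross a different letter.\<close>

lemma sublist_replicate_append_Cons:
  assumes "sublist (replicate m x) (A @ c # B)" "c \<noteq> x"
  shows "sublist (replicate m x) A \<or> sublist (replicate m x) B"
proof -
  have *: "ys = []" if "prefix ys (c # B)" "set ys \<subseteq> {x}" for ys
    using that assms(2) by (cases ys) auto
  from assms(1) consider "sublist (replicate m x) A" | "sublist (replicate m x) (c # B)"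
    | xs ys where "replicate m x = xs @ ys" "suffix xs A" "prefix ys (c # B)"
    by (auto simp: sublist_append)
  then show ?thesis
  proof cases
    case 2
    then show ?thesis using * by (force simp: sublist_Cons_right)
  next
    case 3
    then have "set ys \<subseteq> {x}" by (metis Un_upper2 set_append set_replicate_conv_if
      subset_insertI2 order_trans empty_subsetI subset_refl)
    then show ?thesis using 3 *[of ys] by (auto dest: suffix_imp_sublist)
  qed auto
qed

lemma not_sublist_replicate_block_factors:
  assumes "k < m"
  shows "\<not> sublist (replicate m 0) (concat (block_factors k))"
proof -
  \<comment> \<open>An arbitrary index list lets the induction remove blocks from the front.\<close>
  have "\<not> sublist (replicate m 0) (concat (map (\<lambda>j. replicate j 0 @ [Suc j]) js))"
    if "\<forall>j \<in> set js. j < m" for js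
    using that
  proof (induction js)
    case (Cons j js)
    have "\<not> sublist (replicate m (0::nat)) (replicate j 0)"
      using Cons.prems by (auto dest!: sublist_length_le)
    then show ?case using Cons by (auto dest!: sublist_replicate_append_Cons)
  qed (use assms in simp)
  then show ?thesis using assms by (auto simp: block_factors_def simp del: upt_Suc)
qed

text \<open>The runs before block \<open>Suc k\<close> have length at most \<open>k\<close>, so its
  own run is already a new factor and leaves the fresh separator as a factor by itself.\<close>

lemma lzn_parse_split_factors: "lzn_parse [] (split_factors k)"
proof (induction k)
  case (Suc k)
  have "sublist (replicate k 0) (concat (block_factors k))"
    by (cases k) (auto simp: block_factors_Suc simp del: replicate_Suc intro: sublist_appendI)
  moreover have "\<not> sublist [Suc (Suc k)] (concat (block_factors k) @ replicate (Suc k) 0)"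
    using set_concat_block_factors[of k] by (intro not_sublist_fresh[of "Suc (Suc k)"]) auto
  moreover have "butlast (replicate (Suc k) 0) = replicate k (0::nat)"
    by (simp add: butlast_conv_take min_def del: replicate_Suc)
  ultimately show ?case
    using Suc not_sublist_replicate_block_factors[of k "Suc k"]
    by (simp add: split_factors_Suc lzn_parse_append concat_split_factors del: replicate_Suc)
qed (simp add: split_factors_def)

lemma length_concat_block_factors: "2 * length (concat (block_factors k)) = k * (k + 3)"
  by (induction k) (simp_all add: block_factors_Suc algebra_simps, simp add: block_factors_def)

lemma length_split_factors: "length (split_factors k) = 2 * k"
  by (induction k) (simp_all add: split_factors_Suc, simp add: split_factors_def)

lemma zeta_ge:
  assumes p: "k \<le> p" "2 ^ t \<le> Suc p" "Suc p < 2 ^ Suc t" and k: "0 < k"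
    and n: "2 * n = 2 * Suc p + k * (k + 3)"
  shows "real (2 * k) / real (t + 1 + k) \<le> zeta n"
proof -
  define B where "B = concat (block_factors k)"
  \<comment> \<open>The doubling factors cover \<open>2 ^ t - 1\<close> of the \<open>p\<close>
    zeros. The \<open>r < 2 ^ t\<close> others form one factor with the letter 1.\<close>
  define r where "r = Suc p - 2 ^ t"
  define P where "P = doubling_factors t @ [replicate r 0 @ [1]]"
  define S where "S = concat (P @ block_factors k)"
  have "2 ^ t - 1 + r = p" using p(2) one_le_power[of "2::nat" t] by (simp add: r_def)
  then have P: "concat P = replicate p 0 @ [1]"
    by (simp add: P_def concat_doubling_factors flip: replicate_add append_assoc)
  have "sublist (replicate r 0) (replicate (2 ^ t - 1) (0::nat))"
    using p(3) by (intro sublist_replicate_mono) (simp add: r_def)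
  moreover have "\<not> sublist (replicate r 0 @ [1]) (replicate (2 ^ t - 1) (0::nat))"
    by (intro not_sublist_fresh[of 1]) auto
  ultimately have "lzn_parse [] P"
    by (simp add: P_def lzn_parse_append lzn_parse_doubling_factors concat_doubling_factors
        butlast_append)
  moreover have "lzn_parse (concat P) (block_factors k)"
    using sublist_replicate_mono[OF p(1), of 0]
    by (intro lzn_parse_block_factors) (auto simp: P intro: sublist_order.order_trans)
  ultimately have "lzn_parse [] (P @ block_factors k)" by (simp add: lzn_parse_append)
  then have "zn S = length (P @ block_factors k)" unfolding S_def by (rule zn_concat)
  then have zn_S: "zn S = t + 1 + k" by (simp add: P_def doubling_factors_def block_factors_def)
  have S: "S = replicate p 0 @ [1] @ B" by (simp add: S_def P B_def)
  have len: "2 * length B = k * (k + 3)" unfolding B_def by (rule length_concat_block_factors)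
  then have n_S: "length S = n" using n by (simp add: S)
  have "B \<noteq> []" using len k by auto
  then have i: "p + 2 \<le> n" using n_S by (cases B) (auto simp: S)
  have B: "suffix_at S (p + 2) = B" by (simp add: suffix_at_def substr_def S)
  have zn_B: "zn B = 2 * k"
    using zn_concat[OF lzn_parse_split_factors, of k]
    by (simp add: B_def concat_split_factors length_split_factors)
  have "real (2 * k) / real (t + 1 + k) = real (zn (suffix_at S (p + 2))) / real (zn S)"
    by (simp only: B zn_B zn_S)
  with n_S i have "real (2 * k) / real (t + 1 + k) \<in> zeta_ratios n"
    unfolding zeta_ratios_def by (intro CollectI exI[of _ S] exI[of _ "p + 2"]) simp
  then show ?thesis unfolding zeta_def using finite_zeta_ratios by (intro Max_ge)
qed

section \<open>Asymptotics\<close>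

lemma square_le_two_power: "9 \<le> t \<Longrightarrow> (2 * t + 2)\<^sup>2 \<le> (2::nat) ^ t"
proof (induction t rule: nat_induct_at_least)
  \<comment> \<open>The base case is 400 \<le> 512; the inequality still fails at 8.\<close>
  case (Suc t)
  have "9 * 9 \<le> t * t" using Suc.hyps by (intro mult_le_mono)
  then have "(2 * Suc t + 2)\<^sup>2 \<le> 2 * (2 * t + 2)\<^sup>2"
    by (simp add: power2_eq_square algebra_simps)
  with Suc.IH show ?case by simp
qed simp

lemma zeta_ge_four_thirds:
  assumes "324 \<le> n"
  shows "4 / 3 \<le> zeta n"
proof -
  define k where "k = floor_sqrt n"
  have k: "k\<^sup>2 \<le> n" "n < (Suc k)\<^sup>2"
    using Suc_floor_sqrt_power2_gt[of n] by (simp_all add: k_def)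
  \<comment> \<open>Here 324 is the square of 18.\<close>
  have "18\<^sup>2 < (Suc k)\<^sup>2" using assms k(2) by simp
  then have "18 < Suc k" by (rule power_less_imp_less_base) simp
  then have k18: "18 \<le> k" by simp
  define m where "m = k * (k + 3) div 2"
  then have m: "2 * m = k * (k + 3)" by simp
  have "k * 18 \<le> k\<^sup>2" using k18 by (simp add: power2_eq_square)
  moreover have "2 * m = k\<^sup>2 + k * 3" using m by (simp add: power2_eq_square algebra_simps)
  ultimately have mn: "m + k + 1 \<le> n" using k(1) k18 by arith
  \<comment> \<open>The blocks take \<open>m\<close> letters and \<open>$\<^sub>0\<close> one; the
    initial run absorbs the rest, so every such length \<open>n\<close> is met exactly.\<close>
  define p where "p = n - m - 1"
  have p: "k \<le> p" "n = Suc p + m" using mn by (auto simp: p_def)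
  obtain t where t: "2 ^ t \<le> Suc p" "Suc p < 2 ^ Suc t"
    using ex_power_ivl1[of 2 "Suc p"] by auto
  \<comment> \<open>This is exactly 4/3 \<le> \<open>2 * k / (t + 1 + k)\<close> with the fractions
    cleared. Otherwise \<open>2 ^ t\<close>, hence \<open>n\<close>, would reach
    \<open>(Suc k)\<^sup>2\<close>.\<close>
  have "2 * t + 2 \<le> k"
  proof (rule ccontr)
    assume "\<not> ?thesis"
    then have *: "Suc k \<le> 2 * t + 2" by simp
    then have "9 \<le> t" using k18 by simp
    have "(Suc k)\<^sup>2 \<le> (2 * t + 2)\<^sup>2" using * by (rule power_mono) simp
    also have "\<dots> \<le> 2 ^ t" using \<open>9 \<le> t\<close> by (rule square_le_two_power)
    also have "\<dots> \<le> n" using t p(2) by simp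
    finally show False using k(2) by simp
  qed
  then have "4 / 3 \<le> real (2 * k) / real (t + 1 + k)"
    by (simp add: field_simps)
  also have "\<dots> \<le> zeta n"
    using p t k18 m by (intro zeta_ge[of k p]) auto
  finally show ?thesis .
qed

theorem lemma2: "liminf (\<lambda>n. ereal (zeta n)) \<ge> ereal (4 / 3)"
  by (rule Liminf_bounded, rule eventually_sequentiallyI[of 324]) (simp only: zeta_ge_four_thirds ereal_less_eq)

end
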